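(* Every fixed positive outerplanar forest pattern $P$ can be detected in time $O(n+m)$, i.e. $P$-Detection on ordered graphs with $n$ vertices and $m$ edges can be solved in time $O(n+m)$.
   Context: A pattern $P$ consists of a finite totally ordered vertex set $V(P)$ with a partition of the unordered pairs of distinct vertices into mandatory edges $M(P)$, forbidden edges $F(P)$ and undecided pairs $U(P)$. $P$ is a positive outerplanar forest if $F(P)=\emptyset$, the graph $(V(P),M(P))$ is acyclic, and there are no two mandatory edges $(i,j),(i',j')$ ($i<j$, $i'<j'$) with $i<i'<j<j'$. An ordered graph $(G,\tau)$ (finite simple graph given by adjacency lists, with a total order $\tau$ of its vertices) contains $P$ if there is $X\subseteq V(G)$, $|X|=|V(P)|$, such that under the order-preserving bijection $X\to V(P)$ all mandatory pairs are edges of $G$ (and all forbidden pairs non-edges). $P$-Detection: decide whether $(G,\tau)$ contains $P$. *)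

theory Defs
  imports Main
begin

section \<open>Patterns\<close>

text \<open>The total order on the vertices of a pattern is the order of the type class; unordered pairs
  are two-element sets.\<close>

record 'a pattern =
  pverts :: "'a set"
  mandatory :: "'a set set"
  forbidden :: "'a set set"
  undecided :: "'a set set"

definition unordered_pairs :: "'a set \<Rightarrow> 'a set set" where
  "unordered_pairs V = {{x, y} | x y. x \<in> V \<and> y \<in> V \<and> x \<noteq> y}"

definition is_pattern :: "'a pattern \<Rightarrow> bool" where
  "is_pattern P \<longleftrightarrow>
     finite (pverts P) \<and>
     mandatory P \<union> forbidden P \<union> undecided P = unordered_pairs (pverts P) \<and>
     mandatory P \<inter> forbidden P = {} \<and>
     mandatory P \<inter> undecided P = {} \<and>
     forbidden P \<inter> undecided P = {}"

definition is_cycle :: "'a set set \<Rightarrow> 'a list \<Rightarrow> bool" where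
  "is_cycle E xs \<longleftrightarrow>
     length xs \<ge> 3 \<and> distinct xs \<and>
     (\<forall>i < length xs. {xs ! i, xs ! (Suc i mod length xs)} \<in> E)"

definition positive_outerplanar_forest :: "'a::linorder pattern \<Rightarrow> bool" where
  "positive_outerplanar_forest P \<longleftrightarrow>
     is_pattern P \<and>
     forbidden P = {} \<and>
     (\<nexists>xs. is_cycle (mandatory P) xs) \<and>
     (\<nexists>i j i' j'. {i, j} \<in> mandatory P \<and> {i', j'} \<in> mandatory P \<and> i < i' \<and> i' < j \<and> j < j')"

section \<open>Ordered graphs\<close>

text \<open>The vertices are \<open>0, \<dots>, n - 1\<close>. The list \<open>adj G ! v\<close> contains the neighbours of \<open>v\<close>, in
  arbitrary order, and \<open>order G\<close> enumerates the vertices increasingly with respect to the total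
  order of the ordered graph, which is unrelated to the order of the natural numbers.\<close>

record ograph =
  adj :: "nat list list"
  order :: "nat list"

definition num_verts :: "ograph \<Rightarrow> nat" where
  "num_verts G = length (adj G)"

definition gverts :: "ograph \<Rightarrow> nat set" where
  "gverts G = {..<num_verts G}"

definition gedges :: "ograph \<Rightarrow> nat set set" where
  "gedges G = {{u, v} | u v. u \<in> gverts G \<and> v \<in> set (adj G ! u)}"

definition num_edges :: "ograph \<Rightarrow> nat" where
  "num_edges G = card (gedges G)"

definition ordered_graph :: "ograph \<Rightarrow> bool" where
  "ordered_graph G \<longleftrightarrow>
     (\<forall>u \<in> gverts G. distinct (adj G ! u) \<and> set (adj G ! u) \<subseteq> gverts G - {u}) \<and>
     (\<forall>u \<in> gverts G. \<forall>v \<in> set (adj G ! u). u \<in> set (adj G ! v)) \<and>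
     distinct (order G) \<and> set (order G) = gverts G"

definition precedes :: "ograph \<Rightarrow> nat \<Rightarrow> nat \<Rightarrow> bool" where
  "precedes G u v \<longleftrightarrow>
     (\<exists>i j. i < j \<and> j < length (order G) \<and> order G ! i = u \<and> order G ! j = v)"

definition contains :: "ograph \<Rightarrow> 'a::linorder pattern \<Rightarrow> bool" where
  "contains G P \<longleftrightarrow>
     (\<exists>X f. X \<subseteq> gverts G \<and> card X = card (pverts P) \<and>
        bij_betw f X (pverts P) \<and>
        (\<forall>x \<in> X. \<forall>y \<in> X. precedes G x y \<longrightarrow> f x < f y) \<and>
        (\<forall>x \<in> X. \<forall>y \<in> X. {f x, f y} \<in> mandatory P \<longrightarrow> {x, y} \<in> gedges G) \<and>
        (\<forall>x \<in> X. \<forall>y \<in> X. {f x, f y} \<in> forbidden P \<longrightarrow> {x, y} \<notin> gedges G))"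

section \<open>Random access machines\<close>

text \<open>Structured programs of a unit-cost word RAM. Its memory consists of registers and of arrays
  that are addressed indirectly; registers and arrays are named by constants of the program, so a
  program uses only finitely many of them. There is neither multiplication nor any bit operation;
  subtraction is truncated at zero.\<close>

datatype operand = Const nat | Reg nat

datatype test = Less operand operand | Equal operand operand

datatype prog =
    Skip
  | Move nat operand
  | Add nat operand operand
  | Sub nat operand operand
  | Load nat nat operand  \<comment> \<open>target register, array, index\<close>
  | Store nat operand operand  \<comment> \<open>array, index, value\<close>
  | Seq prog prog
  | Cond test prog prog
  | Loop test prog

record state =
  regs :: "nat \<Rightarrow> nat"
  arrs :: "nat \<Rightarrow> nat \<Rightarrow> nat"

fun val :: "operand \<Rightarrow> state \<Rightarrow> nat" where
  "val (Const c) s = c"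
| "val (Reg r) s = regs s r"

fun holds :: "test \<Rightarrow> state \<Rightarrow> bool" where
  "holds (Less x y) s \<longleftrightarrow> val x s < val y s"
| "holds (Equal x y) s \<longleftrightarrow> val x s = val y s"

definition set_reg :: "nat \<Rightarrow> nat \<Rightarrow> state \<Rightarrow> state" where
  "set_reg r x s = s\<lparr>regs := (regs s)(r := x)\<rparr>"

definition set_arr :: "nat \<Rightarrow> nat \<Rightarrow> nat \<Rightarrow> state \<Rightarrow> state" where
  "set_arr a i x s = s\<lparr>arrs := (arrs s)(a := (arrs s a)(i := x))\<rparr>"

text \<open>\<open>exec W p s t s'\<close>: started in \<open>s\<close>, the program \<open>p\<close> halts after exactly \<open>t\<close> steps in \<open>s'\<close>, on a
  machine whose largest machine word is \<open>W\<close>. An instruction that would write a number exceeding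
  \<open>W\<close> is stuck.\<close>

inductive exec :: "nat \<Rightarrow> prog \<Rightarrow> state \<Rightarrow> nat \<Rightarrow> state \<Rightarrow> bool" for W :: nat where
  exec_Skip: "exec W Skip s 1 s"
| exec_Move: "val x s \<le> W \<Longrightarrow> exec W (Move r x) s 1 (set_reg r (val x s) s)"
| exec_Add: "val x s + val y s \<le> W \<Longrightarrow>
    exec W (Add r x y) s 1 (set_reg r (val x s + val y s) s)"
| exec_Sub: "val x s - val y s \<le> W \<Longrightarrow>
    exec W (Sub r x y) s 1 (set_reg r (val x s - val y s) s)"
| exec_Load: "arrs s a (val i s) \<le> W \<Longrightarrow>
    exec W (Load r a i) s 1 (set_reg r (arrs s a (val i s)) s)"
| exec_Store: "val x s \<le> W \<Longrightarrow>
    exec W (Store a i x) s 1 (set_arr a (val i s) (val x s) s)"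
| exec_Seq: "exec W p s t s' \<Longrightarrow> exec W q s' t' s'' \<Longrightarrow> exec W (Seq p q) s (t + t') s''"
| exec_Cond_True: "holds b s \<Longrightarrow> exec W p s t s' \<Longrightarrow> exec W (Cond b p q) s (t + 1) s'"
| exec_Cond_False: "\<not> holds b s \<Longrightarrow> exec W q s t s' \<Longrightarrow> exec W (Cond b p q) s (t + 1) s'"
| exec_Loop_False: "\<not> holds b s \<Longrightarrow> exec W (Loop b p) s 1 s"
| exec_Loop_True: "holds b s \<Longrightarrow> exec W p s t s' \<Longrightarrow> exec W (Loop b p) s' t' s'' \<Longrightarrow>
    exec W (Loop b p) s (t + t' + 1) s''"

text \<open>Runs are unique, so the existence of a halting run with some property describes the behaviour
  of the program.\<close>

lemma exec_deterministic:
  "exec W p s t s' \<Longrightarrow> exec W p s u r \<Longrightarrow> t = u \<and> s' = r"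
proof (induction arbitrary: u r rule: exec.induct)
  case (exec_Seq p s t s' q t' s'')
  from exec_Seq.prems show ?case
    by cases (use exec_Seq.IH in blast)
next
  case (exec_Cond_True b s p t s' q)
  from exec_Cond_True.prems show ?case
    by cases (use exec_Cond_True.IH exec_Cond_True.hyps in blast)+
next
  case (exec_Cond_False b s q t s' p)
  from exec_Cond_False.prems show ?case
    by cases (use exec_Cond_False.IH exec_Cond_False.hyps in blast)+
next
  case (exec_Loop_True b s p t s' t' s'')
  from exec_Loop_True.prems show ?case
    by cases (use exec_Loop_True.IH exec_Loop_True.hyps in blast)+
qed (erule exec.cases; simp)+

text \<open>Input: register 0 holds the number of vertices, array 0 the vertices in increasing order, and
  array 2 the concatenation of the adjacency lists, where the list of \<open>v\<close> occupies the positions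
  from \<open>A v\<close> up to (excluding) \<open>A (v + 1)\<close> for \<open>A\<close> the array 1. All other cells are 0.\<close>

definition array_of :: "nat list \<Rightarrow> nat \<Rightarrow> nat" where
  "array_of xs i = (if i < length xs then xs ! i else 0)"

definition offsets :: "nat list list \<Rightarrow> nat list" where
  "offsets xss = map (\<lambda>v. length (concat (take v xss))) [0..<Suc (length xss)]"

definition input :: "ograph \<Rightarrow> state" where
  "input G =
     \<lparr>regs = (\<lambda>_. 0)(0 := num_verts G),
      arrs = (\<lambda>_ _. 0)
        (0 := array_of (order G),
         1 := array_of (offsets (adj G)),
         2 := array_of (concat (adj G)))\<rparr>"

end

(* A noncrossing forest on an ordered vertex set can be cut apart along the edge from its first
   vertex x to the last neighbour a of x: since the forest is acyclic, the vertices between x and a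
   fall into an initial segment attached to x and a final segment attached to a, and the vertices
   after a form a third part. The three parts interact only through the images of x and a and
   through the condition that the first part ends before the second one begins. So for each image
   u of x it suffices to know the leftmost position at which the pattern can end, and this value is
   a minimum over the neighbours v of u of values known for the parts; the middle part is treated
   in the reversed order. If x has no neighbour, one takes a minimum over all later vertices. Each
   of these finitely many tables is filled by one sweep over the graph. *)

theory Submission
  imports Defs "HOL-Library.Sublist"
begin

section \<open>Cutting a noncrossing forest\<close>

text \<open>Records only how a pattern is cut, without vertex names, so that tables and programs can
  be defined by recursion on it.\<close>

datatype shape = Single | Gap shape | Edge shape shape shape

text \<open>\<open>Edge\<close> cuts at the edge from \<open>x\<close> to \<open>a\<close>:
  \<open>T\<close> describes the part starting at \<open>x\<close>, \<open>A\<close> the part ending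
  at \<open>a\<close>, read backwards so that it too starts at its attachment vertex, and
  \<open>B\<close> the part from \<open>a\<close> onwards. The vertex \<open>a\<close> belongs to
  both \<open>A\<close> and \<open>B\<close>. The premises \<open>{x} \<notin> E\<close> exclude
  loops, as \<open>{x, y}\<close> with \<open>x = y\<close> is a singleton.\<close>

inductive has_shape :: "'a set set \<Rightarrow> 'a list \<Rightarrow> shape \<Rightarrow> bool" for E where
  Single: "{x} \<notin> E \<Longrightarrow> has_shape E [x] Single"
| Gap: "has_shape E xs T \<Longrightarrow> {x} \<notin> E \<Longrightarrow> \<forall>y\<in>set xs. {x, y} \<notin> E \<Longrightarrow> has_shape E (x # xs) (Gap T)"
| Edge: "has_shape E (x # ws) T \<Longrightarrow> has_shape E (a # rev as) A \<Longrightarrow> has_shape E (a # bs) B \<Longrightarrow>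
    {x, a} \<in> E \<Longrightarrow>
    \<forall>p\<in>set (x # ws). \<forall>q\<in>set (as @ a # bs). {p, q} \<in> E \<longrightarrow> p = x \<and> q = a \<Longrightarrow>
    \<forall>p\<in>set as. \<forall>q\<in>set bs. {p, q} \<notin> E \<Longrightarrow>
    has_shape E (x # ws @ as @ a # bs) (Edge T A B)"

lemma has_shape_not_Nil: "has_shape E xs T \<Longrightarrow> xs \<noteq> []"
  by (induction rule: has_shape.induct) auto

section \<open>Noncrossing vertex lists and the existence of cuts\<close>

definition noncrossing :: "'a set set \<Rightarrow> 'a list \<Rightarrow> bool" where
  "noncrossing E xs \<longleftrightarrow> (\<forall>a b c d. subseq [a, b, c, d] xs \<longrightarrow> {a, c} \<in> E \<longrightarrow> {b, d} \<notin> E)"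

lemma noncrossing_subseq: "noncrossing E xs \<Longrightarrow> subseq ys xs \<Longrightarrow> noncrossing E ys"
  unfolding noncrossing_def by (meson subseq_order.trans)

lemma subseq_rev: "subseq xs ys \<Longrightarrow> subseq (rev xs) (rev ys)"
  by (induction rule: list_emb.induct) (auto intro: list_emb_append_mono)

lemma noncrossing_rev:
  assumes "noncrossing E xs" shows "noncrossing E (rev xs)"
  unfolding noncrossing_def
proof (intro allI impI)
  fix a b c d
  assume "subseq [a, b, c, d] (rev xs)" and "{a, c} \<in> E"
  then have "subseq [d, c, b, a] xs"
    using subseq_rev[of "[a, b, c, d]" "rev xs"] by simp
  with assms \<open>{a, c} \<in> E\<close> show "{b, d} \<notin> E"
    unfolding noncrossing_def by (metis insert_commute)
qed

text \<open>The form in which noncrossing is applied: an edge from \<open>y\<close> to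
  \<open>a\<close> shields the vertices between them from everything after \<open>a\<close>.\<close>

lemma noncrossingD:
  "noncrossing E (ps @ a # qs) \<Longrightarrow> b \<in> set qs \<Longrightarrow> subseq [y, x] ps \<Longrightarrow>
    {y, a} \<in> E \<Longrightarrow> {x, b} \<notin> E"
  unfolding noncrossing_def
proof -
  assume nc: "\<forall>a' b c d. subseq [a', b, c, d] (ps @ a # qs) \<longrightarrow> {a', c} \<in> E \<longrightarrow> {b, d} \<notin> E"
    and b: "b \<in> set qs" and s: "subseq [y, x] ps" and e: "{y, a} \<in> E"
  have "subseq ([y, x] @ a # [b]) (ps @ a # qs)"
    using b s by (intro list_emb_append_mono) (auto simp: subseq_singleton_left)
  then show "{x, b} \<notin> E" using nc e by auto
qed

lemma last_occurrence:
  assumes "\<exists>x\<in>set xs. Q x"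
  obtains ys x zs where "xs = ys @ x # zs" "Q x" "\<forall>z\<in>set zs. \<not> Q z"
  using split_list_last_prop[OF assms] by blast

text \<open>Either the arc from \<open>x\<close> to \<open>a\<close> can be cut, or the greedy walk that always jumps to the last
  neighbour leads from \<open>x\<close> to \<open>a\<close>.\<close>

lemma cut_or_path:
  assumes "noncrossing E (x # ys @ [a])"
  shows "(\<exists>ws as. ys = ws @ as \<and>
      (\<forall>p\<in>set (x # ws). \<forall>q\<in>set (as @ [a]). {p, q} \<in> E \<longrightarrow> p = x \<and> q = a)) \<or>
    (\<exists>ps. ps \<noteq> [] \<and> subseq ps ys \<and> successively (\<lambda>u v. {u, v} \<in> E) (x # ps @ [a]))"
  using assms
proof (induction "length ys" arbitrary: x ys rule: less_induct)
  case less
  show ?case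
  proof (cases "\<exists>j\<in>set ys. {x, j} \<in> E")
    case False
    \<comment> \<open>Without a neighbour to jump to, the cut right after \<open>x\<close>
      works.\<close>
    then have "ys = [] @ ys \<and>
        (\<forall>p\<in>set [x]. \<forall>q\<in>set (ys @ [a]). {p, q} \<in> E \<longrightarrow> p = x \<and> q = a)" by auto
    then show ?thesis by blast
  next
    case True
    then obtain us j vs where ys: "ys = us @ j # vs" and xj: "{x, j} \<in> E"
      and last: "\<forall>z\<in>set vs. {x, z} \<notin> E" by (rule last_occurrence)
    show ?thesis
    proof (cases "{j, a} \<in> E")
      case True
      have "subseq [j] ys" by (simp add: ys subseq_singleton_left)
      moreover have "successively (\<lambda>u v. {u, v} \<in> E) (x # [j] @ [a])"
        using xj True by simp
      ultimately show ?thesis by blast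
    next
      case nja: False
      have "noncrossing E (j # vs @ [a])"
      proof (rule noncrossing_subseq[OF less.prems])
        have "subseq ([] @ (j # vs @ [a])) ((x # us) @ (j # vs @ [a]))"
          by (intro list_emb_append_mono) auto
        then show "subseq (j # vs @ [a]) (x # ys @ [a])" by (simp add: ys)
      qed
      from less.hyps[OF _ this] consider
        ws as where "vs = ws @ as"
          "\<forall>p\<in>set (j # ws). \<forall>q\<in>set (as @ [a]). {p, q} \<in> E \<longrightarrow> p = j \<and> q = a"
      | ps where "subseq ps vs" "successively (\<lambda>u v. {u, v} \<in> E) (j # ps @ [a])"
        using ys by auto
      then show ?thesis
      proof cases
        case 1
        \<comment> \<open>A cut of the arc from \<open>j\<close> to \<open>a\<close> also serves
          \<open>x\<close>: the edge from \<open>x\<close> to \<open>j\<close> shields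
          \<open>us\<close>, and \<open>x\<close> has no neighbour in \<open>vs\<close> by the
          choice of \<open>j\<close>.\<close>
        have "{p, q} \<notin> E" if p: "p \<in> set us" and q: "q \<in> set (as @ [a])" for p q
        proof -
          have xp: "subseq [x, p] (x # us)" using p by (simp add: subseq_singleton_left)
          then show ?thesis
            using noncrossingD[OF _ _ xp, of E j "vs @ [a]" q] less.prems ys 1(1) p q xj by auto
        qed
        then have "\<forall>p\<in>set (x # us @ j # ws). \<forall>q\<in>set (as @ [a]). {p, q} \<in> E \<longrightarrow> p = x \<and> q = a"
          using 1 nja last by auto
        moreover have "ys = (us @ j # ws) @ as" using ys 1 by simp
        ultimately show ?thesis by blast
      next
        case 2
        have "subseq ([] @ (j # ps)) (us @ j # vs)"
          using 2 by (intro list_emb_append_mono) auto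
        then have "subseq (j # ps) ys" by (simp add: ys)
        moreover have "successively (\<lambda>u v. {u, v} \<in> E) (x # (j # ps) @ [a])"
          using 2 xj by simp
        ultimately show ?thesis by blast
      qed
    qed
  qed
qed

lemma is_cycle_of_path:
  assumes "successively (\<lambda>u v. {u, v} \<in> E) xs" "distinct xs" "length xs \<ge> 3"
    and "{hd xs, last xs} \<in> E"
  shows "is_cycle E xs"
  unfolding is_cycle_def
proof (intro conjI allI impI assms)
  fix i assume i: "i < length xs"
  show "{xs ! i, xs ! (Suc i mod length xs)} \<in> E"
  proof (cases "Suc i = length xs")
    case True
    \<comment> \<open>The index modulo the length wraps to 0 here, so the required edge is the
      closing one.\<close>
    then have "xs ! i = last xs" "xs ! 0 = hd xs"
      using i by (metis diff_Suc_1 last_conv_nth list.size(3) not_less0)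
        (use i in \<open>simp add: hd_conv_nth flip: length_greater_0_conv\<close>)
    with True assms(4) show ?thesis by (simp add: insert_commute)
  next
    case False
    with i assms(1) show ?thesis by (simp add: successively_conv_nth)
  qed
qed

text \<open>Induction on the length: each part of a cut is strictly shorter than the list, and
  noncrossing survives in sublists and under reversal.\<close>

lemma has_shape_exists:
  assumes "\<nexists>xs. is_cycle E xs" "\<And>x. {x} \<notin> E"
  shows "noncrossing E xs \<Longrightarrow> distinct xs \<Longrightarrow> xs \<noteq> [] \<Longrightarrow> \<exists>T. has_shape E xs T"
proof (induction "length xs" arbitrary: xs rule: less_induct)
  case less
  then obtain x ys where xs: "xs = x # ys" by (cases xs) auto
  show ?case
  proof (cases "\<exists>a\<in>set ys. {x, a} \<in> E")
    case False
    show ?thesis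
    proof (cases "ys = []")
      case True
      then show ?thesis using has_shape.Single assms(2) xs by metis
    next
      case nonempty: False
      have "noncrossing E ys" by (rule noncrossing_subseq[OF less.prems(1)]) (auto simp: xs)
      with less.hyps[of ys] nonempty less.prems obtain T where "has_shape E ys T"
        by (auto simp: xs)
      with False have "has_shape E xs (Gap T)" unfolding xs
        by (intro has_shape.Gap assms(2)) auto
      then show ?thesis ..
    qed
  next
    case True
    then obtain us a bs where ys: "ys = us @ a # bs" and xa: "{x, a} \<in> E"
      and last: "\<forall>b\<in>set bs. {x, b} \<notin> E" by (rule last_occurrence)
    have sub: "subseq ((x # us @ [a]) @ []) ((x # us @ [a]) @ bs)"
      by (intro list_emb_append_mono) auto
    then have "noncrossing E (x # us @ [a])"
      using noncrossing_subseq[OF less.prems(1)] by (simp add: xs ys)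
    from cut_or_path[OF this] obtain ws as where us: "us = ws @ as"
      and cut: "\<forall>p\<in>set (x # ws). \<forall>q\<in>set (as @ [a]). {p, q} \<in> E \<longrightarrow> p = x \<and> q = a"
    proof (elim disjE exE conjE)
      \<comment> \<open>A path through \<open>us\<close>, closed by the edge \<open>{x, a}\<close>,
        would be a cycle, so only the cut remains.\<close>
      fix ps assume ps: "ps \<noteq> []" "subseq ps us"
        and path: "successively (\<lambda>u v. {u, v} \<in> E) (x # ps @ [a])"
      have "subseq (x # ps @ [a]) (x # us @ [a])"
        using ps by (auto intro!: list_emb_append_mono)
      then have "subseq (x # ps @ [a]) xs"
        using sub by (metis append_Cons append.assoc append_Nil append_Nil2 subseq_order.trans xs ys)
      then obtain N where "x # ps @ [a] = nths xs N" unfolding subseq_conv_nths ..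
      then have "distinct (x # ps @ [a])" using distinct_nthsI[OF less.prems(2)] by metis
      then have "is_cycle E (x # ps @ [a])"
        using path ps xa by (intro is_cycle_of_path) (auto simp: Suc_le_eq)
      then show thesis using assms(1) by blast
    qed blast
    have xs': "xs = x # ws @ as @ a # bs" by (simp add: xs ys us)
    \<comment> \<open>An edge between \<open>us\<close> and \<open>bs\<close> would cross
      \<open>{x, a}\<close>; from \<open>x\<close> itself there is none because \<open>a\<close> is
      its last neighbour.\<close>
    have jump: "{p, q} \<notin> E" if p: "p \<in> set us" and q: "q \<in> set bs" for p q
    proof -
      have xp: "subseq [x, p] (x # us)" using p by (simp add: subseq_singleton_left)
      then show ?thesis
        using noncrossingD[OF _ _ xp, of E a bs q] less.prems p q xa by (auto simp: xs ys)
    qed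
    have "subseq ((x # ws) @ []) ((x # ws) @ as @ a # bs)"
      by (intro list_emb_append_mono) auto
    then have nW: "noncrossing E (x # ws)"
      using noncrossing_subseq[OF less.prems(1)] by (simp add: xs')
    have "subseq ([] @ (as @ [a]) @ []) ((x # ws) @ (as @ [a]) @ bs)"
      by (intro list_emb_append_mono) auto
    then have "noncrossing E (as @ [a])"
      using noncrossing_subseq[OF less.prems(1)] by (simp add: xs')
    then have nA: "noncrossing E (a # rev as)" using noncrossing_rev by fastforce
    have "subseq ([] @ (a # bs)) ((x # ws @ as) @ (a # bs))"
      by (intro list_emb_append_mono) auto
    then have nB: "noncrossing E (a # bs)"
      using noncrossing_subseq[OF less.prems(1)] by (simp add: xs')
    obtain T where T: "has_shape E (x # ws) T"
      using less.hyps[of "x # ws"] nW less.prems(2) by (auto simp: xs')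
    obtain A where A: "has_shape E (a # rev as) A"
      using less.hyps[of "a # rev as"] nA less.prems(2) by (auto simp: xs')
    obtain B where B: "has_shape E (a # bs) B"
      using less.hyps[of "a # bs"] nB less.prems(2) by (auto simp: xs')
    have "has_shape E xs (Edge T A B)" unfolding xs'
      using T A B xa cut jump last us by (intro has_shape.Edge) auto
    then show ?thesis ..
  qed
qed

section \<open>Leftmost embeddings\<close>

locale positioned_graph =
  fixes V :: "'v set" and D :: "'v set set" and pos :: "'v \<Rightarrow> nat" and n :: nat
  assumes finite_V: "finite V"
    and pos_less: "v \<in> V \<Longrightarrow> pos v < n"
begin

text \<open>\<open>True\<close> mirrors the positions within \<open>0\<close> to
  \<open>n - 1\<close>; with mirrored ranks the middle part of a cut looks like any other
  part.\<close>

definition rank :: "bool \<Rightarrow> 'v \<Rightarrow> nat" where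
  "rank d v = (if d then n - 1 - pos v else pos v)"

lemma rank_less: "v \<in> V \<Longrightarrow> rank d v < n"
  using pos_less[of v] by (auto simp: rank_def)

lemma rank_flip: "v \<in> V \<Longrightarrow> rank (\<not> d) v = n - 1 - rank d v"
  using pos_less[of v] by (auto simp: rank_def)

lemma rank_flip_less_iff: "u \<in> V \<Longrightarrow> v \<in> V \<Longrightarrow> rank (\<not> d) u < rank (\<not> d) v \<longleftrightarrow> rank d v < rank d u"
  using rank_less[of u d] rank_less[of v d] by (auto simp: rank_flip)

text \<open>Strictly increasing ranks make \<open>f\<close> injective on the list, and
  \<open>f\<close> matters only there, so embeddings of parts can be pasted.\<close>

definition embeds :: "bool \<Rightarrow> 'a set set \<Rightarrow> 'a list \<Rightarrow> ('a \<Rightarrow> 'v) \<Rightarrow> bool" where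
  "embeds d E xs f \<longleftrightarrow> f ` set xs \<subseteq> V \<and> sorted_wrt (\<lambda>x y. rank d (f x) < rank d (f y)) xs \<and>
     (\<forall>x\<in>set xs. \<forall>y\<in>set xs. {x, y} \<in> E \<longrightarrow> {f x, f y} \<in> D)"

text \<open>The least rank that the last vertex of the pattern can attain if the first one is placed at
  \<open>u\<close>, where \<open>n\<close> means that this placement is impossible.\<close>

fun reach :: "bool \<Rightarrow> shape \<Rightarrow> 'v \<Rightarrow> nat" where
  "reach d Single u = rank d u"
| "reach d (Gap T) u = Min (insert n (reach d T ` {w \<in> V. rank d u < rank d w}))"
| "reach d (Edge T A B) u = Min (insert n (reach d B `
     {v \<in> V. {u, v} \<in> D \<and> reach d T u + reach (\<not> d) A v < n - 1}))"

lemma embeds_cong: "(\<And>x. x \<in> set xs \<Longrightarrow> f x = g x) \<Longrightarrow> embeds d E xs f \<longleftrightarrow> embeds d E xs g"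
proof -
  assume eq: "\<And>x. x \<in> set xs \<Longrightarrow> f x = g x"
  have "f ` set xs = g ` set xs" using eq by (intro image_cong) auto
  moreover have "sorted_wrt (\<lambda>x y. rank d (f x) < rank d (f y)) xs \<longleftrightarrow>
      sorted_wrt (\<lambda>x y. rank d (g x) < rank d (g y)) xs"
    using eq by (auto intro: sorted_wrt_mono_rel[rotated])
  ultimately show ?thesis unfolding embeds_def using eq by simp
qed

lemma embeds_append:
  "embeds d E (xs @ ys) f \<longleftrightarrow> embeds d E xs f \<and> embeds d E ys f \<and>
     (\<forall>x\<in>set xs. \<forall>y\<in>set ys. rank d (f x) < rank d (f y) \<and> ({x, y} \<in> E \<longrightarrow> {f x, f y} \<in> D))"
proof -
  have "(\<forall>y\<in>set ys. \<forall>x\<in>set xs. {y, x} \<in> E \<longrightarrow> {f y, f x} \<in> D) \<longleftrightarrow>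
      (\<forall>x\<in>set xs. \<forall>y\<in>set ys. {x, y} \<in> E \<longrightarrow> {f x, f y} \<in> D)"
  proof -
    have "{y, x} = {x, y}" "{f y, f x} = {f x, f y}" for x y by (simp_all add: insert_commute)
    then show ?thesis by metis
  qed
  then show ?thesis unfolding embeds_def sorted_wrt_append set_append ball_Un image_Un by blast
qed

text \<open>Lets the middle part, which a shape reads backwards from \<open>a\<close>, be treated in
  the mirrored direction.\<close>

lemma embeds_rev: "embeds (\<not> d) E (rev xs) f \<longleftrightarrow> embeds d E xs f"
proof (cases "f ` set xs \<subseteq> V")
  case True
  have "sorted_wrt (\<lambda>x y. rank (\<not> d) (f x) < rank (\<not> d) (f y)) (rev xs) \<longleftrightarrow>
      sorted_wrt (\<lambda>x y. rank d (f x) < rank d (f y)) xs"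
    unfolding sorted_wrt_rev using True
    by (auto intro: sorted_wrt_mono_rel[rotated] simp: rank_flip_less_iff image_subset_iff)
  then show ?thesis by (simp add: embeds_def)
qed (simp add: embeds_def)

lemma embeds_last_ge: "embeds d E xs f \<Longrightarrow> x \<in> set xs \<Longrightarrow> rank d (f x) \<le> rank d (f (last xs))"
  by (induction xs rule: rev_induct) (auto simp: embeds_append intro: less_imp_le)

lemma embeds_hd_le: "embeds d E xs f \<Longrightarrow> x \<in> set xs \<Longrightarrow> rank d (f (hd xs)) \<le> rank d (f x)"
  by (cases xs) (auto simp: embeds_def intro: less_imp_le)

text \<open>Restricting an embedding to the parts of a cut embeds the parts, so the image of
  \<open>hd xs\<close> (for \<open>Gap\<close>) or of \<open>a\<close> (for \<open>Edge\<close>) is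
  a candidate in the minimum defining \<open>reach\<close>.\<close>

lemma reach_le:
  "has_shape E xs T \<Longrightarrow> embeds d E xs f \<Longrightarrow> reach d T (f (hd xs)) \<le> rank d (f (last xs))"
proof (induction arbitrary: d f rule: has_shape.induct)
  case (Single x)
  then show ?case by simp
next
  case (Gap xs T x)
  have ne: "xs \<noteq> []" using has_shape_not_Nil Gap.hyps by blast
  have emb: "embeds d E xs f" and "f (hd xs) \<in> V" "rank d (f x) < rank d (f (hd xs))"
    using Gap.prems ne embeds_append[of d E "[x]" xs f] by (auto simp: embeds_def)
  then have "reach d (Gap T) (f x) \<le> reach d T (f (hd xs))"
    using finite_V by (auto intro: Min_le)
  also have "\<dots> \<le> rank d (f (last xs))" by (rule Gap.IH[OF emb])
  finally show ?case using ne by simp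
next
  case (Edge x ws T a as A bs B)
  \<comment> \<open>The first vertex of the middle part, equal to \<open>a\<close> if
    \<open>as\<close> is empty; the reversed list ends with it.\<close>
  let ?z = "hd (as @ [a])"
  have W: "embeds d E (x # ws) f" and A': "embeds d E (as @ [a]) f" and B: "embeds d E (a # bs) f"
    and lt: "rank d (f (last (x # ws))) < rank d (f ?z)"
    using Edge.prems embeds_append[of d E "x # ws" "as @ a # bs" f]
      embeds_append[of d E "as" "a # bs" f] embeds_append[of d E "as @ [a]" bs f]
      last_in_set[of "x # ws"] list.set_sel(1)[of "as @ [a]"]
    by (auto simp: hd_append)
  have z: "f ?z \<in> V" using A' list.set_sel(1)[of "as @ [a]"] by (auto simp: embeds_def)
  have A: "embeds (\<not> d) E (a # rev as) f" using embeds_rev[of d E "as @ [a]" f] A' by simp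
  have "last (a # rev as) = ?z" by (cases as) auto
  with Edge.IH(2)[OF A] have "reach (\<not> d) A (f a) \<le> n - 1 - rank d (f ?z)"
    by (simp add: rank_flip[OF z])
  \<comment> \<open>A mirrored rank \<open>q\<close> is the rank \<open>n - 1 - q\<close>, so a sum
    below \<open>n - 1\<close> says exactly that the first part ends before the middle part
    begins.\<close>
  with Edge.IH(1)[OF W] lt rank_less[OF z, of d]
  have "reach d T (f x) + reach (\<not> d) A (f a) < n - 1"
    by (simp del: last.simps)
  moreover have "f a \<in> V" "{f x, f a} \<in> D"
    using Edge.prems Edge.hyps by (auto simp: embeds_def)
  ultimately have "reach d (Edge T A B) (f x) \<le> reach d B (f a)"
    using finite_V by (auto intro: Min_le)
  also have "\<dots> \<le> rank d (f (last (a # bs)))" using Edge.IH(3)[OF B] by simp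
  finally show ?case by simp
qed

text \<open>The parts share only the image of \<open>a\<close> and the condition that the first one
  ends before the middle one begins. Hence the first part can be pushed left and the middle part
  right independently, and the optimal embeddings pasted.\<close>

lemma reach_attained:
  "has_shape E xs T \<Longrightarrow> distinct xs \<Longrightarrow> u \<in> V \<Longrightarrow> reach d T u < n \<Longrightarrow>
    \<exists>f. embeds d E xs f \<and> f (hd xs) = u \<and> rank d (f (last xs)) = reach d T u"
proof (induction arbitrary: d u rule: has_shape.induct)
  case (Single x)
  then have "embeds d E [x] (\<lambda>_. u)" by (simp add: embeds_def)
  then show ?case by auto
next
  case (Gap xs T x)
  have ne: "xs \<noteq> []" using has_shape_not_Nil Gap.hyps by blast
  let ?S = "insert n (reach d T ` {w \<in> V. rank d u < rank d w})"
  \<comment> \<open>Being below \<open>n\<close>, the minimum is not the default and comes from some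
    vertex.\<close>
  have "Min ?S \<in> ?S" using finite_V by (intro Min_in) auto
  with Gap.prems obtain w where w: "w \<in> V" "rank d u < rank d w" "reach d (Gap T) u = reach d T w"
    by auto
  with Gap.IH[of w d] Gap.prems obtain f where
    f: "embeds d E xs f" "f (hd xs) = w" "rank d (f (last xs)) = reach d T w" by auto
  let ?g = "\<lambda>a. if a = x then u else f a"
  have g: "?g y = f y" if "y \<in> set xs" for y using that Gap.prems by auto
  have "embeds d E xs ?g" using f embeds_cong[of xs f ?g] g by simp
  moreover have "rank d u < rank d (?g y)" if "y \<in> set xs" for y
    using embeds_hd_le[OF f(1) that] f(2) w(2) g[OF that] by simp
  moreover have "embeds d E [x] ?g" using Gap.hyps Gap.prems by (simp add: embeds_def)
  ultimately have "embeds d E ([x] @ xs) ?g" unfolding embeds_append using Gap.hyps by auto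
  moreover have "rank d (?g (last (x # xs))) = reach d (Gap T) u"
    unfolding g[OF last_in_set[OF ne]] last_ConsR[OF ne] f(3) w(3) ..
  ultimately show ?case by (intro exI[of _ ?g]) simp
next
  case (Edge x ws T a as A bs B)
  let ?S = "insert n (reach d B ` {v \<in> V. {u, v} \<in> D \<and> reach d T u + reach (\<not> d) A v < n - 1})"
  have "Min ?S \<in> ?S" using finite_V by (intro Min_in) auto
  with Edge.prems obtain v where v: "v \<in> V" "{u, v} \<in> D"
    "reach d T u + reach (\<not> d) A v < n - 1" "reach d (Edge T A B) u = reach d B v" by auto
  \<comment> \<open>An impossible part would contribute \<open>n\<close> and violate the inequality,
    so both parts embed.\<close>
  then have less: "reach d T u < n" "reach (\<not> d) A v < n" by linarith+
  obtain f where f: "embeds d E (x # ws) f" "f x = u" "rank d (f (last (x # ws))) = reach d T u"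
    using Edge.IH(1)[OF _ \<open>u \<in> V\<close> less(1)] Edge.prems(1) by auto
  obtain g where g: "embeds (\<not> d) E (a # rev as) g" "g a = v"
    "rank (\<not> d) (g (last (a # rev as))) = reach (\<not> d) A v"
    using Edge.IH(2)[OF _ v(1) less(2)] Edge.prems(1) by auto
  obtain h where h: "embeds d E (a # bs) h" "h a = v" "rank d (h (last (a # bs))) = reach d B v"
    using Edge.IH(3)[OF _ v(1), of d] Edge.prems(1,3) v(4) by auto
  \<comment> \<open>The first part is disjoint from the others, which overlap only in
    \<open>a\<close>, where \<open>g\<close> and \<open>h\<close> agree.\<close>
  define k where "k y = (if y \<in> set (x # ws) then f y else if y \<in> set (as @ [a]) then g y else h y)"
    for y
  have kf: "k y = f y" if "y \<in> set (x # ws)" for y using that by (simp add: k_def)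
  have kg: "k y = g y" if "y \<in> set (as @ [a])" for y using that Edge.prems(1) by (auto simp: k_def)
  have kh: "k y = h y" if "y \<in> set (a # bs)" for y using that Edge.prems(1) h(2) g(2) by (auto simp: k_def)
  let ?z = "hd (as @ [a])"
  have z: "last (a # rev as) = ?z" "?z \<in> set (as @ [a])" by (cases as; simp)+
  have g': "embeds d E (as @ [a]) g" using g(1) embeds_rev[of d E "as @ [a]" g] by simp
  have gz: "g ?z \<in> V" using g' z by (auto simp: embeds_def)
  \<comment> \<open>Undoing the mirroring in the inequality separates the first part from the middle
    one.\<close>
  have "reach d T u < rank d (g ?z)"
    using g(3) v(3) rank_flip[OF gz, of d] rank_less[OF gz, of d] unfolding z by linarith
  then have fg: "rank d (f p) < rank d (g q)" if "p \<in> set (x # ws)" "q \<in> set (as @ [a])" for p q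
    using embeds_last_ge[OF f(1) that(1)] embeds_hd_le[OF g' that(2)] f(3) by linarith
  have gle: "rank d (g p) \<le> rank d v" if "p \<in> set (as @ [a])" for p
    using embeds_last_ge[OF g' that] g(2) by simp
  have hle: "rank d v < rank d (h p)" if "p \<in> set bs" for p
    using h(1,2) that by (auto simp: embeds_def)
  have fh: "rank d (f p) < rank d (h q)" if "p \<in> set (x # ws)" "q \<in> set (a # bs)" for p q
  proof (cases "q = a")
    case True
    then show ?thesis using fg[OF that(1), of a] g(2) h(2) by simp
  next
    case False
    then show ?thesis using fg[OF that(1), of a] g(2) h(2) hle[of q] that by simp
  qed
  have e1: "embeds d E (x # ws) k" using f(1) embeds_cong[of "x # ws" f k] kf by simp
  have e2: "embeds d E (as @ [a]) k" using g' embeds_cong[of "as @ [a]" g k] kg by simp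
  have e3: "embeds d E (a # bs) k" using h(1) embeds_cong[of "a # bs" h k] kh by simp
  have e2': "embeds d E as k" and e23: "\<And>p. p \<in> set as \<Longrightarrow> rank d (k p) < rank d (k a) \<and> ({p, a} \<in> E \<longrightarrow> {k p, k a} \<in> D)"
    using e2 unfolding embeds_append by auto
  have ka: "k a = v" using kh[of a] h(2) by simp
  have e4: "embeds d E (as @ a # bs) k" unfolding embeds_append
  proof (intro conjI e2' e3 ballI)
    fix p q assume p: "p \<in> set as" and q: "q \<in> set (a # bs)"
    show "rank d (k p) < rank d (k q)"
    proof (cases "q = a")
      case True then show ?thesis using e23[OF p] by blast
    next
      case False
      then have "rank d v < rank d (k q)" using kh[OF q] hle q by simp
      then show ?thesis using e23[OF p] ka by simp
    qed
    show "{p, q} \<in> E \<longrightarrow> {k p, k q} \<in> D"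
    proof (cases "q = a")
      case True
      then show ?thesis using e23[OF p] by blast
    next
      case False
      then show ?thesis using Edge.hyps(6) p q by simp
    qed
  qed
  have "embeds d E ((x # ws) @ as @ a # bs) k" unfolding embeds_append[of _ _ "x # ws"]
  proof (intro conjI e1 e4 ballI)
    fix p q assume p: "p \<in> set (x # ws)" and q: "q \<in> set (as @ a # bs)"
    consider "q \<in> set (as @ [a])" | "q \<in> set (a # bs)" using q by auto
    then show "rank d (k p) < rank d (k q)"
    proof cases
      case 1
      show ?thesis unfolding kf[OF p] kg[OF 1] by (rule fg[OF p 1])
    next
      case 2
      show ?thesis unfolding kf[OF p] kh[OF 2] by (rule fh[OF p 2])
    qed
    have "k x = u" using kf[of x] f(2) by simp
    with Edge.hyps(5) p q ka v(2) show "{p, q} \<in> E \<longrightarrow> {k p, k q} \<in> D" by metis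
  qed
  moreover have "k x = u" using kf[of x] f(2) by simp
  moreover have "rank d (k (last (x # ws @ as @ a # bs))) = reach d (Edge T A B) u"
  proof -
    have eq: "last (x # ws @ as @ a # bs) = last (a # bs)" by simp
    show ?thesis unfolding eq kh[OF last_in_set[OF list.discI[OF refl]]] h(3) v(4) ..
  qed
  ultimately show ?case by (intro exI[of _ k]) simp
qed

lemma embeds_iff_reach:
  assumes "has_shape E xs T" "distinct xs"
  shows "(\<exists>f. embeds d E xs f) \<longleftrightarrow> (\<exists>u\<in>V. reach d T u < n)"
proof
  assume "\<exists>f. embeds d E xs f"
  then obtain f where f: "embeds d E xs f" ..
  have "xs \<noteq> []" using has_shape_not_Nil assms by blast
  with f have "f (hd xs) \<in> V" "f (last xs) \<in> V" by (auto simp: embeds_def)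
  with reach_le[OF assms(1) f] rank_less show "\<exists>u\<in>V. reach d T u < n"
    using le_less_trans by blast
next
  assume "\<exists>u\<in>V. reach d T u < n"
  then show "\<exists>f. embeds d E xs f" using reach_attained[OF assms] by blast
qed

lemma reach_le_n: "v \<in> V \<Longrightarrow> reach d T v \<le> n"
  using finite_V rank_less[of v d] by (cases T) (auto intro: Min_le)

end

section \<open>Total correctness with running times\<close>

text \<open>A weakest precondition that also sees the number of steps and includes
  termination.\<close>

definition run :: "nat \<Rightarrow> prog \<Rightarrow> state \<Rightarrow> (nat \<Rightarrow> state \<Rightarrow> bool) \<Rightarrow> bool" where
  "run W p s Q \<longleftrightarrow> (\<exists>t s'. exec W p s t s' \<and> Q t s')"

lemma run_mono: "run W p s Q \<Longrightarrow> (\<And>t s'. Q t s' \<Longrightarrow> R t s') \<Longrightarrow> run W p s R"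
  unfolding run_def by blast

inductive_cases exec_SkipE: "exec W Skip s t s'"
inductive_cases exec_MoveE: "exec W (Move r x) s t s'"
inductive_cases exec_AddE: "exec W (Add r x y) s t s'"
inductive_cases exec_SubE: "exec W (Sub r x y) s t s'"
inductive_cases exec_LoadE: "exec W (Load r a i) s t s'"
inductive_cases exec_StoreE: "exec W (Store a i x) s t s'"
inductive_cases exec_SeqE: "exec W (Seq p q) s t s'"
inductive_cases exec_CondE: "exec W (Cond b p q) s t s'"

text \<open>As rewrite rules these execute loop-free code symbolically, collecting word-size
  conditions and step counts.\<close>

lemma run_simps [simp]:
  "run W Skip s Q \<longleftrightarrow> Q 1 s"
  "run W (Move r x) s Q \<longleftrightarrow> val x s \<le> W \<and> Q 1 (set_reg r (val x s) s)"
  "run W (Add r x y) s Q \<longleftrightarrow> val x s + val y s \<le> W \<and> Q 1 (set_reg r (val x s + val y s) s)"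
  "run W (Sub r x y) s Q \<longleftrightarrow> val x s - val y s \<le> W \<and> Q 1 (set_reg r (val x s - val y s) s)"
  "run W (Load r a x) s Q \<longleftrightarrow>
     arrs s a (val x s) \<le> W \<and> Q 1 (set_reg r (arrs s a (val x s)) s)"
  "run W (Store a x y) s Q \<longleftrightarrow> val y s \<le> W \<and> Q 1 (set_arr a (val x s) (val y s) s)"
  "run W (Seq p q) s Q \<longleftrightarrow> run W p s (\<lambda>t s'. run W q s' (\<lambda>u. Q (t + u)))"
  "run W (Cond b p q) s Q \<longleftrightarrow> run W (if holds b s then p else q) s (\<lambda>t. Q (t + 1))"
  unfolding run_def
proof goal_cases
  case 1
  show ?case by (metis exec_Skip exec_SkipE)
next
  case 2
  show ?case by (metis exec_Move exec_MoveE)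
next
  case 3
  show ?case by (metis exec_Add exec_AddE)
next
  case 4
  show ?case by (metis exec_Sub exec_SubE)
next
  case 5
  show ?case by (metis exec_Load exec_LoadE)
next
  case 6
  show ?case by (metis exec_Store exec_StoreE)
next
  case 7
  show ?case by (blast intro: exec.intros elim!: exec_SeqE)
next
  case 8
  have "exec W (Cond b p q) s t s' \<longleftrightarrow>
      (\<exists>u. t = u + 1 \<and> exec W (if holds b s then p else q) s u s')" for t s'
    by (auto elim!: exec_CondE intro: exec_Cond_True[simplified] exec_Cond_False[simplified])
  then show ?case by auto
qed

text \<open>The potential \<open>\<Phi>\<close> pays for the running time and thereby also ensures termination.\<close>

lemma run_Loop:
  assumes "I s"
    and step: "\<And>s. I s \<Longrightarrow> holds b s \<Longrightarrow> run W p s (\<lambda>t s'. I s' \<and> t + 1 + \<Phi> s' \<le> \<Phi> s)"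
  shows "run W (Loop b p) s (\<lambda>t s'. I s' \<and> \<not> holds b s' \<and> t \<le> \<Phi> s + 1)"
  using \<open>I s\<close>
\<comment> \<open>Each iteration and its test are paid out of \<open>\<Phi>\<close>; the additional
  1 is the final test that fails.\<close>
proof (induction "\<Phi> s" arbitrary: s rule: less_induct)
  case less
  show ?case
  proof (cases "holds b s")
    case True
    then obtain t s' where s': "exec W p s t s'" "I s'" "t + 1 + \<Phi> s' \<le> \<Phi> s"
      using step[OF less.prems] unfolding run_def by blast
    then obtain u s'' where "exec W (Loop b p) s' u s''" "I s''" "\<not> holds b s''" "u \<le> \<Phi> s' + 1"
      using less.hyps[of s'] unfolding run_def by auto
    with s' True show ?thesis unfolding run_def
      by (intro exI[of _ "t + u + 1"] exI[of _ s'']) (use exec_Loop_True in force)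
  next
    case False
    with less.prems show ?thesis unfolding run_def
      by (intro exI[of _ 1] exI[of _ s]) (auto simp del: One_nat_def intro: exec_Loop_False)
  qed
qed

lemma regs_set_reg [simp]: "regs (set_reg r x s) q = (if q = r then x else regs s q)"
  and arrs_set_reg [simp]: "arrs (set_reg r x s) = arrs s"
  and regs_set_arr [simp]: "regs (set_arr a i x s) = regs s"
  and arrs_set_arr [simp]:
    "arrs (set_arr a i x s) b = (if b = a then (arrs s a)(i := x) else arrs s b)"
  by (auto simp: set_reg_def set_arr_def)

fun block :: "prog list \<Rightarrow> prog" where
  "block [] = Skip"
| "block (p # ps) = Seq p (block ps)"

section \<open>The detection program\<close>

definition lower :: "nat \<Rightarrow> nat \<Rightarrow> prog" where
  "lower r x = Cond (Less (Reg x) (Reg r)) (Move r (Reg x)) Skip"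

lemma run_lower [simp]: "run W (lower r x) s Q \<longleftrightarrow>
    (if regs s x < regs s r then regs s x \<le> W \<and> Q 2 (set_reg r (regs s x) s) else Q 2 s)"
  by (simp add: lower_def numeral_2_eq_2)

text \<open>Arrays 0 to 2 are the input. Arrays 3 and 4 will hold the positions and the mirrored
  positions, array 5 the reversed order; tables start at array 6.\<close>

definition order_array :: "bool \<Rightarrow> nat" where "order_array d = (if d then 5 else 0)"
definition rank_array :: "bool \<Rightarrow> nat" where "rank_array d = (if d then 4 else 3)"

text \<open>Throughout, register 0 holds \<open>n\<close> and register 1 holds \<open>n - 1\<close>.\<close>

definition prelude_step :: prog where
  "prelude_step = block
     [Load 4 0 (Reg 2),
      Store 3 (Reg 4) (Reg 2),
      Sub 5 (Reg 1) (Reg 2),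
      Store 4 (Reg 4) (Reg 5),
      Store 5 (Reg 5) (Reg 4),
      Add 2 (Reg 2) (Const 1)]"

definition prelude :: prog where
  "prelude = block
     [Sub 1 (Reg 0) (Const 1),
      Move 2 (Const 0),
      Loop (Less (Reg 2) (Reg 0)) prelude_step]"

definition single_step :: "bool \<Rightarrow> nat \<Rightarrow> prog" where
  "single_step d a = block
     [Load 3 (rank_array d) (Reg 2),
      Store a (Reg 2) (Reg 3),
      Add 2 (Reg 2) (Const 1)]"

text \<open>The sweep runs from the last rank down. An entry is stored before the vertex itself
  enters the running minimum, because only strictly later vertices count.\<close>

definition gap_step :: "bool \<Rightarrow> nat \<Rightarrow> prog" where
  "gap_step d a = block
     [Sub 2 (Reg 2) (Const 1),
      Load 4 (order_array d) (Reg 2),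
      Store a (Reg 4) (Reg 3),
      Load 5 (a + 1) (Reg 4),
      lower 3 5]"

text \<open>Register 3 is the running minimum, 6 the position in the adjacency array, 8 the value of
  the first part at the current vertex. Register 9 receives the sum that is compared with
  \<open>n - 1\<close>.\<close>

definition scan_step :: "nat \<Rightarrow> prog" where
  "scan_step a = block
     [Load 4 2 (Reg 6),
      Load 9 (a + 2) (Reg 4),
      Add 9 (Reg 8) (Reg 9),
      Load 5 (a + 3) (Reg 4),
      Cond (Less (Reg 9) (Reg 1)) (lower 3 5) Skip,
      Add 6 (Reg 6) (Const 1)]"

text \<open>Starting the minimum at \<open>n\<close> encodes impossibility. Register 10 is the next
  vertex, used both to look up the end of the adjacency list and to advance the sweep.\<close>

definition edge_step :: "nat \<Rightarrow> prog" where
  "edge_step a = block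
     [Move 3 (Reg 0),
      Load 8 (a + 1) (Reg 2),
      Load 6 1 (Reg 2),
      Add 10 (Reg 2) (Const 1),
      Load 7 1 (Reg 10),
      Loop (Less (Reg 6) (Reg 7)) (scan_step a),
      Store a (Reg 2) (Reg 3),
      Move 2 (Reg 10)]"

text \<open>\<open>tabulate d T a\<close> writes the table of \<open>reach d T\<close> to the array \<open>a\<close> and uses the arrays
  above \<open>a\<close> as scratch space.\<close>

fun tabulate :: "bool \<Rightarrow> shape \<Rightarrow> nat \<Rightarrow> prog" where
  "tabulate d Single a = block
     [Move 2 (Const 0),
      Loop (Less (Reg 2) (Reg 0)) (single_step d a)]"
| "tabulate d (Gap T) a = block
     [tabulate d T (a + 1),
      Move 2 (Reg 0),
      Move 3 (Reg 0),
      Loop (Less (Const 0) (Reg 2)) (gap_step d a)]"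
| "tabulate d (Edge T A B) a = block
     [tabulate d T (a + 1),
      tabulate (\<not> d) A (a + 2),
      tabulate d B (a + 3),
      Move 2 (Const 0),
      Loop (Less (Reg 2) (Reg 0)) (edge_step a)]"

fun cost :: "shape \<Rightarrow> nat" where
  "cost Single = 10"
| "cost (Gap T) = cost T + 20"
| "cost (Edge T A B) = cost T + cost A + cost B + 40"

definition detect_step :: prog where
  "detect_step = block
     [Load 4 6 (Reg 2),
      Cond (Less (Reg 4) (Reg 0)) (Move 3 (Const 1)) Skip,
      Add 2 (Reg 2) (Const 1)]"

definition detect :: "shape \<Rightarrow> prog" where
  "detect T = block
     [prelude,
      tabulate False T 6,
      Move 2 (Const 0),
      Move 3 (Const 0),
      Loop (Less (Reg 2) (Reg 0)) detect_step,
      Move 0 (Reg 3)]"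

section \<open>Positions in the order and offsets of the adjacency lists\<close>

definition position :: "ograph \<Rightarrow> nat \<Rightarrow> nat" where
  "position G v = inv_into {..<num_verts G} ((!) (order G)) v"

definition offset :: "ograph \<Rightarrow> nat \<Rightarrow> nat" where
  "offset G v = length (concat (take v (adj G)))"

lemma offset_0 [simp]: "offset G 0 = 0"
  by (simp add: offset_def)

lemma offset_Suc: "v < num_verts G \<Longrightarrow> offset G (Suc v) = offset G v + length (adj G ! v)"
  by (simp add: offset_def num_verts_def take_Suc_conv_app_nth)

lemma offset_num_verts: "offset G (num_verts G) = length (concat (adj G))"
  by (simp add: offset_def num_verts_def)

lemma offset_mono: "u \<le> v \<Longrightarrow> v \<le> num_verts G \<Longrightarrow> offset G u \<le> offset G v"
  by (induction v rule: dec_induct) (auto simp: offset_Suc)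

lemma offsets_nth: "v \<le> num_verts G \<Longrightarrow> array_of (offsets (adj G)) v = offset G v"
  by (auto simp: array_of_def offsets_def offset_def num_verts_def simp del: upt_Suc)

text \<open>Splitting the concatenation around the list of \<open>v\<close> shows that cell
  \<open>offset G v + j\<close> holds its \<open>j\<close>-th entry.\<close>

lemma neighbours_array:
  assumes "v < num_verts G"
  shows "array_of (concat (adj G)) ` {offset G v..<offset G (Suc v)} = set (adj G ! v)"
proof -
  let ?xs = "concat (take v (adj G))" and ?ys = "adj G ! v" and ?zs = "concat (drop (Suc v) (adj G))"
  have split: "concat (adj G) = ?xs @ ?ys @ ?zs"
    using assms id_take_nth_drop[of v "adj G"]
    by (metis concat.simps(2) concat_append num_verts_def)
  have eq: "array_of (concat (adj G)) (offset G v + j) = ?ys ! j" if "j < length ?ys" for j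
    using that unfolding split by (simp add: array_of_def offset_def nth_append)
  have "{offset G v..<offset G (Suc v)} = (+) (offset G v) ` {..<length ?ys}"
    by (simp add: offset_Suc[OF assms] lessThan_atLeast0 add.commute)
  then have "array_of (concat (adj G)) ` {offset G v..<offset G (Suc v)} = (!) ?ys ` {..<length ?ys}"
    using eq by (auto simp: image_image)
  then show ?thesis by (auto simp: in_set_conv_nth image_def)
qed

text \<open>As the lists are distinct, their total length counts ordered pairs of adjacent vertices,
  and an edge accounts for at most two of them.\<close>

lemma length_concat_adj:
  assumes "ordered_graph G"
  shows "length (concat (adj G)) \<le> 2 * num_edges G"
proof -
  let ?D = "Sigma (gverts G) (\<lambda>u. set (adj G ! u))"
  have sub: "e \<subseteq> gverts G" if "e \<in> gedges G" for e
    using that assms unfolding gedges_def ordered_graph_def by blast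
  have fin: "finite (gedges G)"
    by (rule finite_subset[of _ "Pow (gverts G)"]) (use sub in \<open>auto simp: gverts_def\<close>)
  have "length (concat (adj G)) = (\<Sum>u<num_verts G. length (adj G ! u))"
    by (simp add: length_concat num_verts_def sum_list_sum_nth lessThan_atLeast0)
  also have "\<dots> = card ?D"
    using assms by (simp add: gverts_def ordered_graph_def distinct_card)
  also have "\<dots> \<le> card (\<Union>e\<in>gedges G. {(u, v). e = {u, v} \<and> u \<noteq> v})"
  proof (rule card_mono)
    have "(\<Union>e\<in>gedges G. {(u, v). e = {u, v} \<and> u \<noteq> v}) \<subseteq> gverts G \<times> gverts G"
      using sub by auto
    then show "finite (\<Union>e\<in>gedges G. {(u, v). e = {u, v} \<and> u \<noteq> v})"
      by (rule finite_subset) (simp add: gverts_def)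
    show "?D \<subseteq> (\<Union>e\<in>gedges G. {(u, v). e = {u, v} \<and> u \<noteq> v})"
    proof clarify
      fix u v assume "u \<in> gverts G" "v \<in> set (adj G ! u)"
      then have "{u, v} \<in> gedges G" "u \<noteq> v"
        using assms unfolding gedges_def ordered_graph_def by blast+
      then show "(u, v) \<in> (\<Union>e\<in>gedges G. {(u, v). e = {u, v} \<and> u \<noteq> v})" by blast
    qed
  qed
  also have "\<dots> \<le> (\<Sum>e\<in>gedges G. card {(u, v). e = {u, v} \<and> u \<noteq> v})"
    by (rule card_UN_le[OF fin])
  also have "\<dots> \<le> (\<Sum>e\<in>gedges G. 2)"
  proof (rule sum_mono)
    fix e assume "e \<in> gedges G"
    then obtain u v where e: "e = {u, v}" by (auto simp: gedges_def)
    have "{(x, y). e = {x, y} \<and> x \<noteq> y} \<subseteq> set [(u, v), (v, u)]"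
      unfolding e by (auto simp: doubleton_eq_iff)
    then have "card {(x, y). e = {x, y} \<and> x \<noteq> y} \<le> card (set [(u, v), (v, u)])"
      by (intro card_mono) auto
    also have "\<dots> \<le> length [(u, v), (v, u)]" by (rule card_length)
    finally show "card {(x, y). e = {x, y} \<and> x \<noteq> y} \<le> 2" by simp
  qed
  finally show ?thesis by (simp add: num_edges_def)
qed

section \<open>Correctness of the program\<close>

text \<open>The sum of two table entries can reach \<open>2 * num_verts G\<close>, and a position in
  the adjacency array can reach its length; both must fit into a word.\<close>

locale machine_input =
  fixes G :: ograph and W :: nat
  assumes ordered: "ordered_graph G"
    and word_verts: "2 * num_verts G + 2 \<le> W"
    and word_edges: "length (concat (adj G)) + 1 \<le> W"
begin

abbreviation "n \<equiv> num_verts G"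
abbreviation "l \<equiv> length (concat (adj G))"

lemma length_order: "length (order G) = n"
  using ordered unfolding ordered_graph_def gverts_def
  by (metis card_lessThan distinct_card)

lemma inj_order: "inj_on ((!) (order G)) {..<n}"
  using ordered length_order by (auto simp: ordered_graph_def inj_on_nth)

lemma order_image: "(!) (order G) ` {..<n} = gverts G"
  using ordered length_order
  by (auto simp: ordered_graph_def set_conv_nth[of "order G"] image_def simp flip: lessThan_iff)

lemma order_position: "v < n \<Longrightarrow> order G ! position G v = v"
  unfolding position_def using order_image by (intro f_inv_into_f) (auto simp: gverts_def)

lemma position_less: "v < n \<Longrightarrow> position G v < n"
  unfolding position_def using order_image inv_into_into[of v "(!) (order G)" "{..<n}"]
  by (auto simp: gverts_def)

lemma position_order: "i < n \<Longrightarrow> position G (order G ! i) = i"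
  unfolding position_def using inj_order by (auto intro: inv_into_f_f)

lemma order_less: "i < n \<Longrightarrow> order G ! i < n"
  using order_image by (auto simp: gverts_def)

sublocale positioned_graph "gverts G" "gedges G" "position G" n
  by unfold_locales (auto simp: gverts_def position_less)

lemma edge_iff: "u < n \<Longrightarrow> {u, v} \<in> gedges G \<longleftrightarrow> v \<in> set (adj G ! u)"
  using ordered unfolding gedges_def ordered_graph_def gverts_def
  by (auto simp only: mem_Collect_eq doubleton_eq_iff lessThan_iff)

lemma adj_less: "u < n \<Longrightarrow> v \<in> set (adj G ! u) \<Longrightarrow> v < n"
  using ordered unfolding ordered_graph_def gverts_def by blast

lemma precedes_iff: "u < n \<Longrightarrow> v < n \<Longrightarrow> precedes G u v \<longleftrightarrow> position G u < position G v"
  unfolding precedes_def length_order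
  using order_position[of u] order_position[of v] position_less[of u] position_less[of v]
    position_order by (auto intro: exI[of _ "position G u"])

text \<open>What the prelude establishes and all later code preserves, since it writes only to
  arrays from 6 on. The last two conjuncts make the rank and order arrays mutually inverse.\<close>

definition ready :: "state \<Rightarrow> bool" where
  "ready s \<longleftrightarrow> regs s 0 = n \<and> regs s 1 = n - 1 \<and>
     arrs s 1 = array_of (offsets (adj G)) \<and> arrs s 2 = array_of (concat (adj G)) \<and>
     (\<forall>d. \<forall>v<n. arrs s (rank_array d) v = rank d v \<and> arrs s (order_array d) (rank d v) = v) \<and>
     (\<forall>d. \<forall>i<n. arrs s (order_array d) i < n \<and> rank d (arrs s (order_array d) i) = i)"

lemma ready_cong:
  "ready s \<Longrightarrow> regs s' 0 = regs s 0 \<Longrightarrow> regs s' 1 = regs s 1 \<Longrightarrow> (\<And>b. b < 6 \<Longrightarrow> arrs s' b = arrs s b) \<Longrightarrow>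
    ready s'"
  unfolding ready_def rank_array_def order_array_def by simp

lemma run_prelude: "run W prelude (input G) (\<lambda>t s. ready s \<and> t \<le> 10 * n + 10)"
proof -
  let ?I = "\<lambda>s. regs s 0 = n \<and> regs s 1 = n - 1 \<and> regs s 2 \<le> n \<and>
     arrs s 0 = array_of (order G) \<and>
     arrs s 1 = array_of (offsets (adj G)) \<and> arrs s 2 = array_of (concat (adj G)) \<and>
     (\<forall>j<regs s 2. arrs s 3 (order G ! j) = j \<and> arrs s 4 (order G ! j) = n - 1 - j \<and>
        arrs s 5 (n - 1 - j) = order G ! j)"
  have ready: "ready s" if "?I s" "\<not> regs s 2 < regs s 0" for s
  proof -
    have j: "arrs s 0 j = order G ! j \<and> arrs s 3 (order G ! j) = j \<and>
        arrs s 4 (order G ! j) = n - 1 - j \<and> arrs s 5 (n - 1 - j) = order G ! j" if "j < n" for j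
      using that \<open>?I s\<close> \<open>\<not> regs s 2 < regs s 0\<close> by (auto simp: array_of_def length_order)
    have v: "arrs s 0 (position G v) = v \<and> arrs s 3 v = position G v \<and>
        arrs s 4 v = n - 1 - position G v \<and> arrs s 5 (n - 1 - position G v) = v" if "v < n" for v
      using j[OF position_less[OF that]] by (simp add: order_position[OF that])
    have i: "arrs s 5 i = order G ! (n - 1 - i)" if "i < n" for i
      using j[of "n - 1 - i"] that by auto
    show ?thesis unfolding ready_def rank_array_def order_array_def rank_def
      using v i j \<open>?I s\<close> by (auto simp: order_less position_order)
  qed
  have loop: "run W (Loop (Less (Reg 2) (Reg 0)) prelude_step) s
       (\<lambda>t s'. ?I s' \<and> \<not> holds (Less (Reg 2) (Reg 0)) s' \<and> t \<le> 10 * (n - regs s 2) + 1)"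
    if "?I s" for s
  proof (rule run_Loop[where \<Phi> = "\<lambda>s. 10 * (n - regs s 2)"])
    fix s assume "?I s" "holds (Less (Reg 2) (Reg 0)) s"
    moreover from this have "order G ! regs s 2 < n" "array_of (order G) (regs s 2) = order G ! regs s 2"
      by (auto simp: order_less array_of_def length_order)
    \<comment> \<open>Injectivity of the order keeps earlier entries of the rank arrays from being
      overwritten.\<close>
    ultimately show "run W prelude_step s
       (\<lambda>t s'. ?I s' \<and> t + 1 + 10 * (n - regs s' 2) \<le> 10 * (n - regs s 2))"
      using word_verts inj_order unfolding prelude_step_def
      by (auto simp: less_Suc_eq inj_on_eq_iff)
  qed (rule that)
  show ?thesis unfolding prelude_def
    using word_verts by (auto simp: input_def intro!: run_mono[OF loop] ready)
qed

section \<open>Sweeps that fill the tables\<close>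

definition best :: "(nat \<Rightarrow> nat) \<Rightarrow> (nat \<Rightarrow> bool) \<Rightarrow> nat set \<Rightarrow> nat" where
  "best f Q S = Min (insert n (f ` {v \<in> S. Q v}))"

lemma best_empty [simp]: "best f Q {} = n"
  by (simp add: best_def)

text \<open>Scanning one more vertex costs one comparison, the one made by
  \<open>lower\<close>.\<close>

lemma best_insert: "finite S \<Longrightarrow>
    best f Q (insert v S) = (if Q v then min (f v) (best f Q S) else best f Q S)"
proof -
  assume "finite S"
  moreover have "{x \<in> insert v S. Q x} = (if Q v then insert v {x \<in> S. Q x} else {x \<in> S. Q x})"
    by auto
  ultimately show ?thesis by (simp add: best_def insert_commute[of n])
qed

lemma reach_Gap: "reach d (Gap T) u = best (reach d T) (\<lambda>_. True) {w \<in> gverts G. rank d u < rank d w}"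
  by (simp add: best_def)

text \<open>Restricting the minimum from all vertices to one adjacency list is what keeps the sweep
  linear.\<close>

lemma reach_Edge:
  assumes "u < n"
  shows "reach d (Edge T A B) u =
    best (reach d B) (\<lambda>v. reach d T u + reach (\<not> d) A v < n - 1) (set (adj G ! u))"
proof -
  have "{v \<in> gverts G. {u, v} \<in> gedges G \<and> Q v} = {v \<in> set (adj G ! u). Q v}" for Q
    using edge_iff[OF assms] adj_less[OF assms] by (auto simp: gverts_def)
  then show ?thesis by (simp add: best_def)
qed

lemma ready_regs:
  assumes "ready s"
  shows "regs s 0 = n" "regs s 1 = n - 1" "regs s (Suc 0) = n - 1"
  using assms by (simp_all add: ready_def)

lemma reach_word: "v < n \<Longrightarrow> reach d T v \<le> n"
  using reach_le_n[of v d T] by (simp add: gverts_def)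

lemma offset_word: "v \<le> n \<Longrightarrow> offset G v < W"
  using offset_mono[of v n G] word_edges by (simp add: offset_num_verts)

lemma run_tabulate_Single:
  assumes "ready s\<^sub>0" "6 \<le> a"
  shows "run W (tabulate d Single a) s\<^sub>0 (\<lambda>t s. ready s \<and>
     (\<forall>b<a. arrs s b = arrs s\<^sub>0 b) \<and> (\<forall>v<n. arrs s a v = reach d Single v) \<and> t \<le> 10 * (n + l + 1))"
proof -
  let ?I = "\<lambda>s. ready s \<and> (\<forall>b<a. arrs s b = arrs s\<^sub>0 b) \<and> regs s 2 \<le> n \<and>
    (\<forall>v<regs s 2. arrs s a v = rank d v)"
  have loop: "run W (Loop (Less (Reg 2) (Reg 0)) (single_step d a)) s
       (\<lambda>t s'. ?I s' \<and> \<not> holds (Less (Reg 2) (Reg 0)) s' \<and> t \<le> 10 * (n - regs s 2) + 1)"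
    if "?I s" for s
  proof (rule run_Loop[where \<Phi> = "\<lambda>s. 10 * (n - regs s 2)"])
    fix s assume I: "?I s" and h: "holds (Less (Reg 2) (Reg 0)) s"
    then have "arrs s (rank_array d) (regs s 2) = rank d (regs s 2)" "rank d (regs s 2) < n"
      using rank_less[of "regs s 2" d] by (auto simp: ready_def gverts_def)
    then show "run W (single_step d a) s
        (\<lambda>t s'. ?I s' \<and> t + 1 + 10 * (n - regs s' 2) \<le> 10 * (n - regs s 2))"
      unfolding single_step_def using I h word_verts assms(2)
      by (auto simp: less_Suc_eq ready_regs intro!: ready_cong[of s])
  qed (rule that)
  show ?thesis using assms
    by (auto simp: ready_regs intro!: run_mono[OF loop] ready_cong[of s\<^sub>0])
qed

text \<open>Invariant: the vertices of rank at least register 2 have their entries, and register 3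
  is the minimum over them.\<close>

lemma run_gap_loop:
  assumes "6 \<le> a" and "ready s" "regs s 2 = n" "regs s 3 = n"
    and "\<forall>b<a. arrs s b = arrs s\<^sub>0 b" "\<forall>v<n. arrs s (a + 1) v = reach d T v"
  shows "run W (Loop (Less (Const 0) (Reg 2)) (gap_step d a)) s (\<lambda>t s'. ready s' \<and>
     (\<forall>b<a. arrs s' b = arrs s\<^sub>0 b) \<and> (\<forall>v<n. arrs s' a v = reach d (Gap T) v) \<and> t \<le> 10 * n + 1)"
proof -
  let ?R = "\<lambda>i. {w \<in> gverts G. i \<le> rank d w}"
  let ?I = "\<lambda>s. ready s \<and> (\<forall>b<a. arrs s b = arrs s\<^sub>0 b) \<and> (\<forall>v<n. arrs s (a + 1) v = reach d T v) \<and>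
    regs s 2 \<le> n \<and> regs s 3 = best (reach d T) (\<lambda>_. True) (?R (regs s 2)) \<and>
    (\<forall>v\<in>?R (regs s 2). arrs s a v = reach d (Gap T) v)"
  have "run W (Loop (Less (Const 0) (Reg 2)) (gap_step d a)) s
       (\<lambda>t s'. ?I s' \<and> \<not> holds (Less (Const 0) (Reg 2)) s' \<and> t \<le> 10 * regs s 2 + 1)"
  proof (rule run_Loop[where \<Phi> = "\<lambda>s. 10 * regs s 2"])
    have "?R n = {}" using rank_less by (auto simp: not_le)
    then show "?I s" using assms by (simp only: best_empty ball_empty order_refl)
  next
    fix s assume I: "?I s" and h: "holds (Less (Const 0) (Reg 2)) s"
    define i where "i = regs s 2 - 1"
    define w where "w = arrs s (order_array d) i"
    have i: "regs s 2 = Suc i" "i < n" using h I by (auto simp: i_def)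
    then have w: "w < n" "rank d w = i" using I by (auto simp: ready_def w_def)
    \<comment> \<open>The order array inverts the rank, so at most one vertex has rank
      \<open>i\<close>.\<close>
    have unique: "v = w" if "v \<in> gverts G" "rank d v = i" for v
      using that I by (auto simp: ready_def w_def gverts_def)
    have "v \<in> ?R i \<longleftrightarrow> v \<in> insert w (?R (Suc i))" for v
      using unique[of v] w by (cases "rank d v = i") (auto simp: gverts_def)
    then have R: "?R i = insert w (?R (Suc i))" by blast
    have later: "\<forall>v. v \<noteq> w \<longrightarrow> v \<in> gverts G \<longrightarrow> i \<le> rank d v \<longrightarrow> arrs s a v = reach d (Gap T) v"
      using I unique i by (auto simp: Suc_le_eq le_less simp del: reach.simps)
    have fin: "finite (?R j)" for j by (simp add: gverts_def)
    \<comment> \<open>The running minimum before \<open>w\<close> is included is already the entry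
      due at \<open>w\<close>.\<close>
    have b: "best (reach d T) (\<lambda>_. True) (?R (Suc i)) = reach d (Gap T) w"
      unfolding reach_Gap w(2) Suc_le_eq ..
    have ins: "best (reach d T) (\<lambda>_. True) (?R i) = min (reach d T w) (reach d (Gap T) w)"
      unfolding R best_insert[OF fin] b by simp
    show "run W (gap_step d a) s (\<lambda>t s'. ?I s' \<and> t + 1 + 10 * regs s' 2 \<le> 10 * regs s 2)"
      unfolding gap_step_def using I assms(1) word_verts i w later b ins reach_word[OF w(1), of d T]
        reach_word[OF w(1), of d "Gap T"]
      by (auto simp: R min_def ready_regs w_def[symmetric] simp del: reach.simps intro!: ready_cong[of s])
  qed
  then show ?thesis
    by (rule run_mono) (use assms in \<open>auto simp: gverts_def simp del: reach.simps\<close>)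
qed

text \<open>Invariant: register 3 is the minimum over the neighbours stored before position register
  6. One iteration per neighbour gives a time proportional to the degree.\<close>

lemma run_scan_loop:
  assumes "ready s" "i < n" "regs s 3 = n" "regs s 6 = offset G i" "regs s 7 = offset G (Suc i)"
    and "regs s 2 = i" "regs s 10 = Suc i" "regs s 8 = reach d T i"
    and "\<forall>v<n. arrs s (a + 2) v = reach (\<not> d) A v" "\<forall>v<n. arrs s (a + 3) v = reach d B v"
  shows "run W (Loop (Less (Reg 6) (Reg 7)) (scan_step a)) s (\<lambda>t s'. ready s' \<and> arrs s' = arrs s \<and>
     regs s' 2 = i \<and> regs s' 10 = Suc i \<and> regs s' 3 = reach d (Edge T A B) i \<and>
     t \<le> 14 * length (adj G ! i) + 1)"
proof -
  let ?nb = "array_of (concat (adj G))"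
  let ?b = "\<lambda>p. best (reach d B) (\<lambda>v. reach d T i + reach (\<not> d) A v < n - 1) (?nb ` {offset G i..<p})"
  let ?I = "\<lambda>s'. ready s' \<and> arrs s' = arrs s \<and> regs s' 2 = i \<and> regs s' 10 = Suc i \<and>
    regs s' 7 = offset G (Suc i) \<and> regs s' 8 = reach d T i \<and> offset G i \<le> regs s' 6 \<and>
    regs s' 6 \<le> offset G (Suc i) \<and> regs s' 3 = ?b (regs s' 6)"
  have "run W (Loop (Less (Reg 6) (Reg 7)) (scan_step a)) s
       (\<lambda>t s'. ?I s' \<and> \<not> holds (Less (Reg 6) (Reg 7)) s' \<and> t \<le> 14 * (offset G (Suc i) - regs s 6) + 1)"
  proof (rule run_Loop[where \<Phi> = "\<lambda>s. 14 * (offset G (Suc i) - regs s 6)"])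
    show "?I s" using assms by (simp add: offset_Suc)
  next
    fix s' assume I: "?I s'" and h: "holds (Less (Reg 6) (Reg 7)) s'"
    define p where "p = regs s' 6"
    define v where "v = ?nb p"
    have p: "offset G i \<le> p" "p < offset G (Suc i)" using I h by (auto simp: p_def)
    have "v \<in> set (adj G ! i)" unfolding neighbours_array[OF assms(2), symmetric] v_def
      using p by (intro imageI) simp
    then have v: "v < n" by (rule adj_less[OF assms(2)])
    have arr: "arrs s' 2 p = v" "arrs s' (a + 2) v = reach (\<not> d) A v" "arrs s' (a + 3) v = reach d B v"
      using I v assms by (auto simp: ready_def v_def)
    have "?b (Suc p) = (if reach d T i + reach (\<not> d) A v < n - 1 then min (reach d B v) (?b p) else ?b p)"
      unfolding v_def using p by (simp add: atLeastLessThanSuc best_insert)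
    moreover have "Suc p < W" using p offset_word[of "Suc i"] assms(2) by simp
    ultimately show "run W (scan_step a) s' (\<lambda>t s''. ?I s'' \<and>
        t + 1 + 14 * (offset G (Suc i) - regs s'' 6) \<le> 14 * (offset G (Suc i) - regs s' 6))"
      unfolding scan_step_def using I p arr v word_verts reach_word[OF v, of d B]
        reach_word[OF v, of "\<not> d" A] reach_word[OF assms(2), of d T]
      by (auto simp: p_def[symmetric] min_def ready_regs intro!: ready_cong[of s'])
  qed
  then show ?thesis
  proof (rule run_mono)
    fix t s' assume *: "?I s' \<and> \<not> holds (Less (Reg 6) (Reg 7)) s' \<and>
      t \<le> 14 * (offset G (Suc i) - regs s 6) + 1"
    then have "regs s' 6 = offset G (Suc i)" by simp
    with * show "ready s' \<and> arrs s' = arrs s \<and> regs s' 2 = i \<and> regs s' 10 = Suc i \<and>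
        regs s' 3 = reach d (Edge T A B) i \<and> t \<le> 14 * length (adj G ! i) + 1"
      unfolding reach_Edge[OF assms(2)] neighbours_array[OF assms(2), symmetric]
      using offset_Suc[OF assms(2)] assms(4) by simp
  qed
qed

text \<open>The potential adds the adjacency entries not yet scanned to the vertices not yet
  treated, so the inner loops sum to \<open>l\<close> instead of \<open>n\<close> times the largest
  degree.\<close>

lemma run_edge_loop:
  assumes "6 \<le> a" and "ready s" "regs s 2 = 0"
    and "\<forall>b<a. arrs s b = arrs s\<^sub>0 b" "\<forall>v<n. arrs s (a + 1) v = reach d T v"
    and "\<forall>v<n. arrs s (a + 2) v = reach (\<not> d) A v" "\<forall>v<n. arrs s (a + 3) v = reach d B v"
  shows "run W (Loop (Less (Reg 2) (Reg 0)) (edge_step a)) s (\<lambda>t s'. ready s' \<and>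
     (\<forall>b<a. arrs s' b = arrs s\<^sub>0 b) \<and> (\<forall>v<n. arrs s' a v = reach d (Edge T A B) v) \<and>
     t \<le> 14 * l + 20 * n + 1)"
proof -
  let ?I = "\<lambda>s. ready s \<and> (\<forall>b<a. arrs s b = arrs s\<^sub>0 b) \<and> (\<forall>v<n. arrs s (a + 1) v = reach d T v) \<and>
    (\<forall>v<n. arrs s (a + 2) v = reach (\<not> d) A v) \<and> (\<forall>v<n. arrs s (a + 3) v = reach d B v) \<and>
    regs s 2 \<le> n \<and> (\<forall>v<regs s 2. arrs s a v = reach d (Edge T A B) v)"
  let ?\<Phi> = "\<lambda>s. 14 * (l - offset G (regs s 2)) + 20 * (n - regs s 2)"
  have "run W (Loop (Less (Reg 2) (Reg 0)) (edge_step a)) s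
       (\<lambda>t s'. ?I s' \<and> \<not> holds (Less (Reg 2) (Reg 0)) s' \<and> t \<le> ?\<Phi> s + 1)"
  proof (rule run_Loop[where \<Phi> = ?\<Phi>])
    show "?I s" using assms by (simp del: reach.simps)
  next
    fix s assume I: "?I s" and h: "holds (Less (Reg 2) (Reg 0)) s"
    define i where "i = regs s 2"
    have i: "i < n" using I h by (auto simp: i_def ready_regs)
    have l: "offset G (Suc i) \<le> l" using offset_mono[of "Suc i" n G] i by (simp add: offset_num_verts)
    have off: "arrs s (Suc 0) i = offset G i" "arrs s (Suc 0) (Suc i) = offset G (Suc i)"
      using I i by (simp_all add: ready_def offsets_nth)
    show "run W (edge_step a) s (\<lambda>t s'. ?I s' \<and> t + 1 + ?\<Phi> s' \<le> ?\<Phi> s)"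
      unfolding edge_step_def block.simps run_simps(1-7)
    proof (intro conjI, goal_cases)
      \<comment> \<open>The sixth goal is the inner loop; the others are word-size conditions of the
        instructions before it.\<close>
      case 6
      show ?case
      proof (rule run_mono[OF run_scan_loop[of _ i d T a A B]], goal_cases)
        case (11 t s')
        then have s': "ready s'" "arrs s' = arrs s" "regs s' 2 = i" "regs s' 10 = Suc i"
          "regs s' 3 = reach d (Edge T A B) i" "t \<le> 14 * length (adj G ! i) + 1" by auto
        show ?case using s' I i l word_verts assms(1) reach_word[OF i, of d "Edge T A B"]
          by (auto simp: i_def[symmetric] offset_Suc simp del: reach.simps intro!: ready_cong[of s'])
      qed (use I i off in \<open>auto simp: i_def[symmetric] ready_regs intro!: ready_cong[of s]\<close>)
    qed (use I i off word_verts offset_word[of i] offset_word[of "Suc i"] reach_word[OF i, of d T]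
      in \<open>auto simp: i_def[symmetric] ready_regs\<close>)
  qed
  then show ?thesis
    by (rule run_mono) (use assms in \<open>auto simp: ready_regs simp del: reach.simps\<close>)
qed

text \<open>Induction on the shape for every direction and base array. Because arrays below the base
  are untouched, tables of earlier parts survive the computation of later ones.\<close>

lemma run_tabulate:
  "ready s \<Longrightarrow> 6 \<le> a \<Longrightarrow> run W (tabulate d T a) s (\<lambda>t s'. ready s' \<and>
     (\<forall>b<a. arrs s' b = arrs s b) \<and> (\<forall>v<n. arrs s' a v = reach d T v) \<and> t \<le> cost T * (n + l + 1))"
proof (induction T arbitrary: s a d)
  case Single
  then show ?case using run_tabulate_Single[of s a d] by simp
next
  case (Gap T)
  have W: "n \<le> W" using word_verts by simp
  have "run W (Seq (Move 2 (Reg 0)) (Seq (Move 3 (Reg 0))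
      (Seq (Loop (Less (Const 0) (Reg 2)) (gap_step d a)) Skip))) s'
    (\<lambda>u s''. ready s'' \<and> (\<forall>b<a. arrs s'' b = arrs s b) \<and> (\<forall>v<n. arrs s'' a v = reach d (Gap T) v) \<and>
       t + u \<le> cost (Gap T) * (n + l + 1))"
    if "ready s'" "\<forall>b<a+1. arrs s' b = arrs s b" "\<forall>v<n. arrs s' (a + 1) v = reach d T v"
      "t \<le> cost T * (n + l + 1)" for t s'
    using that W Gap.prems
    by (auto simp: ready_regs algebra_simps simp del: reach.simps
        intro!: run_mono[OF run_gap_loop[of a _ s d T]] ready_cong[of s'])
  with Gap.IH[of s "a + 1" d] Gap.prems show ?case
    by (auto simp del: reach.simps cost.simps run_simps(2) elim!: run_mono)
next
  case (Edge T A B)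
  have loop: "run W (Seq (Move 2 (Const 0)) (Seq (Loop (Less (Reg 2) (Reg 0)) (edge_step a)) Skip)) s3
    (\<lambda>u s'. ready s' \<and> (\<forall>b<a. arrs s' b = arrs s b) \<and> (\<forall>v<n. arrs s' a v = reach d (Edge T A B) v) \<and>
       t1 + (t2 + (t3 + u)) \<le> cost (Edge T A B) * (n + l + 1))"
    if "ready s3" "\<forall>b<a. arrs s3 b = arrs s b" "\<forall>v<n. arrs s3 (a + 1) v = reach d T v"
      "\<forall>v<n. arrs s3 (a + 2) v = reach (\<not> d) A v" "\<forall>v<n. arrs s3 (a + 3) v = reach d B v"
      "t1 \<le> cost T * (n + l + 1)" "t2 \<le> cost A * (n + l + 1)" "t3 \<le> cost B * (n + l + 1)"
    for t1 t2 t3 s3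
    using that Edge.prems
    by (auto simp: ready_regs algebra_simps simp del: reach.simps
        intro!: run_mono[OF run_edge_loop[of a _ s d T A B]] ready_cong[of s3])
  show ?case unfolding tabulate.simps block.simps run_simps(7)
  proof (rule run_mono[OF Edge.IH(1)[of s "a + 1" d]], goal_cases)
    case s1: (3 t1 s1)
    show ?case
    proof (rule run_mono[OF Edge.IH(2)[of s1 "a + 2" "\<not> d"]], goal_cases)
      case s2: (3 t2 s2)
      show ?case
      proof (rule run_mono[OF Edge.IH(3)[of s2 "a + 3" d]], goal_cases)
        case s3: (3 t3 s3)
        show ?case
          using s1 s2 s3 by (intro loop[unfolded run_simps(7)]) (auto simp del: reach.simps)
      qed (use s2 \<open>6 \<le> a\<close> in auto)
    qed (use s1 \<open>6 \<le> a\<close> in auto)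
  qed (use Edge.prems in auto)
qed

lemma run_detect:
  "run W (detect T) (input G) (\<lambda>t s. t \<le> (cost T + 40) * (n + l + 1) \<and>
     regs s 0 = (if \<exists>v<n. reach False T v < n then 1 else 0))"
proof -
  let ?I = "\<lambda>s. ready s \<and> (\<forall>v<n. arrs s 6 v = reach False T v) \<and> regs s 2 \<le> n \<and>
    regs s 3 = (if \<exists>v<regs s 2. reach False T v < n then 1 else 0)"
  have loop: "run W (Loop (Less (Reg 2) (Reg 0)) detect_step) s
       (\<lambda>t s'. ?I s' \<and> \<not> holds (Less (Reg 2) (Reg 0)) s' \<and> t \<le> 10 * (n - regs s 2) + 1)"
    if "?I s" for s
  proof (rule run_Loop[where \<Phi> = "\<lambda>s. 10 * (n - regs s 2)"])
    fix s assume I: "?I s" and h: "holds (Less (Reg 2) (Reg 0)) s"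
    then have "regs s 2 < n" by (auto simp: ready_regs)
    then show "run W detect_step s (\<lambda>t s'. ?I s' \<and> t + 1 + 10 * (n - regs s' 2) \<le> 10 * (n - regs s 2))"
      unfolding detect_step_def using I word_verts reach_word[of "regs s 2" False T]
      by (auto simp: less_Suc_eq ready_regs intro!: ready_cong[of s])
  qed (rule that)
  show ?thesis unfolding detect_def block.simps run_simps(7)
  proof (rule run_mono[OF run_prelude], goal_cases)
    case s1: (1 t1 s1)
    then show ?case
    proof (intro run_mono[OF run_tabulate[of s1 6 False T]], goal_cases)
      case s2: (3 t2 s2)
      have "t1 + t2 + 10 * n + 20 \<le> (cost T + 40) * (n + l + 1)"
        using s1 s2 by (auto simp: algebra_simps)
      then show ?case using s2 word_verts
        by (auto simp: ready_regs intro!: run_mono[OF loop] ready_cong[of s2])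
    qed auto
  qed
qed

end

section \<open>From containment of the pattern to embeddings of its sorted vertex list\<close>

context machine_input
begin

text \<open>\<open>contains\<close> maps graph vertices to the pattern and \<open>embeds\<close>
  goes the other way; the two maps are inverse to each other.\<close>

lemma contains_iff_embeds:
  fixes P :: "'a::linorder pattern"
  assumes "finite (pverts P)" "forbidden P = {}"
  shows "contains G P \<longleftrightarrow> (\<exists>g. embeds False (mandatory P) (sorted_list_of_set (pverts P)) g)"
    (is "_ \<longleftrightarrow> (\<exists>g. embeds False _ ?xs g)")
proof
  have inj: "u = v" if "u < n" "v < n" "position G u = position G v" for u v
    using that order_position by metis
  assume "contains G P"
  then obtain X f where X: "X \<subseteq> gverts G" and bij: "bij_betw f X (pverts P)"
    and mono: "\<forall>x\<in>X. \<forall>y\<in>X. precedes G x y \<longrightarrow> f x < f y"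
    and edge: "\<forall>x\<in>X. \<forall>y\<in>X. {f x, f y} \<in> mandatory P \<longrightarrow> {x, y} \<in> gedges G"
    unfolding contains_def by (elim exE conjE)
  define g where "g = inv_into X f"
  have fg: "f (g x) = x" if "x \<in> pverts P" for x
    unfolding g_def by (rule bij_betw_inv_into_right[OF bij that])
  have gX: "g x \<in> X" if "x \<in> pverts P" for x
    unfolding g_def by (rule bij_betw_apply[OF bij_betw_inv_into[OF bij] that])
  have gn: "g x < n" if "x \<in> pverts P" for x using gX[OF that] X by (auto simp: gverts_def)
  have "position G (g x) < position G (g y)" if xy: "x \<in> pverts P" "y \<in> pverts P" "x < y" for x y
  proof (rule ccontr)
    assume "\<not> position G (g x) < position G (g y)"
    \<comment> \<open>Equal positions would identify \<open>x\<close> and \<open>y\<close>, and the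
      opposite order contradicts the monotonicity of \<open>f\<close>.\<close>
    then consider "position G (g x) = position G (g y)" | "position G (g y) < position G (g x)"
      by linarith
    then show False
    proof cases
      case 1
      then have "g x = g y" by (rule inj[OF gn[OF xy(1)] gn[OF xy(2)]])
      then have "x = y" using fg[OF xy(1)] fg[OF xy(2)] by metis
      then show False using xy(3) by simp
    next
      case 2
      then have "precedes G (g y) (g x)" using gn xy by (simp add: precedes_iff)
      then show False
        using bspec[OF bspec[OF mono gX[OF xy(2)]] gX[OF xy(1)]] fg[OF xy(1)] fg[OF xy(2)] xy(3) by simp
    qed
  qed
  then have "sorted_wrt (\<lambda>x y. position G (g x) < position G (g y)) ?xs"
    using assms by (intro sorted_wrt_mono_rel[OF _ strict_sorted_list_of_set]) auto
  moreover have "{g x, g y} \<in> gedges G"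
    if "x \<in> pverts P" "y \<in> pverts P" "{x, y} \<in> mandatory P" for x y
    using bspec[OF bspec[OF edge gX[OF that(1)]] gX[OF that(2)]] fg[OF that(1)] fg[OF that(2)] that(3)
    by simp
  ultimately have "embeds False (mandatory P) ?xs g"
    unfolding embeds_def rank_def using assms gX X by auto
  then show "\<exists>g. embeds False (mandatory P) ?xs g" by blast
next
  assume "\<exists>g. embeds False (mandatory P) ?xs g"
  then obtain g where g: "embeds False (mandatory P) ?xs g" ..
  have gn: "g x < n" if "x \<in> pverts P" for x
    using g that assms unfolding embeds_def by (auto simp: gverts_def)
  have mono: "position G (g x) < position G (g y)" if xy: "x \<in> pverts P" "y \<in> pverts P" "x < y" for x y
  proof -
    obtain i j where ij: "i < length ?xs" "j < length ?xs" "?xs ! i = x" "?xs ! j = y"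
      using xy assms by (metis in_set_conv_nth set_sorted_list_of_set)
    then have "i < j"
      using xy sorted_nth_mono[OF sorted_sorted_list_of_set, of j i "pverts P"] by (metis leD leI)
    then show ?thesis using g ij unfolding embeds_def rank_def sorted_wrt_iff_nth_less by auto
  qed
  \<comment> \<open>Strict monotonicity gives injectivity, which supplies the inverse and the right
    cardinality of the image.\<close>
  have inj_g: "inj_on g (pverts P)"
    by (rule inj_onI) (metis mono less_irrefl linorder_less_linear)
  let ?f = "inv_into (pverts P) g"
  have f: "?f (g x) = x" if "x \<in> pverts P" for x using inj_g that by simp
  have "bij_betw ?f (g ` pverts P) (pverts P)" using inj_g by (simp add: bij_betw_inv_into inj_on_imp_bij_betw)
  moreover have "x < y" if "x \<in> pverts P" "y \<in> pverts P" "precedes G (g x) (g y)" for x y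
  proof -
    have less: "position G (g x) < position G (g y)"
      using that precedes_iff[OF gn[OF that(1)] gn[OF that(2)]] by simp
    show ?thesis
    proof (rule ccontr)
      assume "\<not> x < y"
      then consider "x = y" | "y < x" by fastforce
      then show False by cases (use less mono[OF that(2,1)] in auto)
    qed
  qed
  moreover have "{g x, g y} \<in> gedges G"
    if "x \<in> pverts P" "y \<in> pverts P" "{x, y} \<in> mandatory P" for x y
    using g that assms unfolding embeds_def by auto
  moreover have "g ` pverts P \<subseteq> gverts G" using gn by (auto simp: gverts_def)
  ultimately show "contains G P" unfolding contains_def assms(2)
    by (intro exI[of _ "g ` pverts P"] exI[of _ ?f]) (simp add: card_image[OF inj_g] f)
qed

end

text \<open>A subsequence of the strictly sorted list is strictly increasing, so four such vertices
  form exactly the forbidden crossing.\<close>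

lemma noncrossing_sorted_list:
  assumes "positive_outerplanar_forest P"
  shows "noncrossing (mandatory P) (sorted_list_of_set (pverts P))"
  unfolding noncrossing_def
proof (intro allI impI)
  fix a b c d
  assume s: "subseq [a, b, c, d] (sorted_list_of_set (pverts P))" and "{a, c} \<in> mandatory P"
  from s have "sorted_wrt (<) [a, b, c, d]"
    using sorted_nths distinct_nthsI sorted_sorted_list_of_set distinct_sorted_list_of_set
    unfolding subseq_conv_nths strict_sorted_iff by metis
  then have "a < b" "b < c" "c < d" by auto
  with \<open>{a, c} \<in> mandatory P\<close> show "{b, d} \<notin> mandatory P"
    using assms unfolding positive_outerplanar_forest_def by blast
qed

theorem theorem9:
  fixes P :: "'a::linorder pattern"
  assumes "positive_outerplanar_forest P"
  shows "\<exists>prog c k. \<forall>G. ordered_graph G \<longrightarrow>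
    (\<exists>t s. exec ((num_verts G + num_edges G + 2) ^ k) prog (input G) t s \<and>
       t \<le> c * (num_verts G + num_edges G + 1) \<and>
       regs s 0 = (if contains G P then 1 else 0))"
proof (cases "pverts P = {}")
  case True
  \<comment> \<open>A shape needs a nonempty list; the empty pattern lies in every graph, so a
    constant answer suffices.\<close>
  then have "contains G P" for G
    by (auto simp: contains_def bij_betw_def intro!: exI[of _ "{}"])
  moreover have "run (Suc (Suc m) ^ 2) (Move 0 (Const 1)) (input G) (\<lambda>t s. t \<le> 1 \<and> regs s 0 = 1)" for m G
    by simp
  ultimately show ?thesis
    by (intro exI[of _ "Move 0 (Const 1)"] exI[of _ 1] exI[of _ 2]) (force simp: run_def)
next
  case False
  let ?E = "mandatory P" and ?xs = "sorted_list_of_set (pverts P)"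
  have fin: "finite (pverts P)" and forb: "forbidden P = {}" and acyclic: "\<nexists>xs. is_cycle ?E xs"
    and pairs: "?E \<subseteq> unordered_pairs (pverts P)"
    using assms by (auto simp: positive_outerplanar_forest_def is_pattern_def)
  have "{x} \<notin> ?E" for x using pairs by (auto simp: unordered_pairs_def)
  \<comment> \<open>The shape is obtained from the pattern before any graph is fixed, so
    \<open>detect T\<close> is one program for all inputs.\<close>
  with has_shape_exists[OF acyclic _ noncrossing_sorted_list[OF assms]] False fin
  obtain T where T: "has_shape ?E ?xs T" by auto
  have "\<exists>t s. exec ((num_verts G + num_edges G + 2) ^ 2) (detect T) (input G) t s \<and>
      t \<le> 2 * (cost T + 40) * (num_verts G + num_edges G + 1) \<and>
      regs s 0 = (if contains G P then 1 else 0)" if G: "ordered_graph G" for G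
  proof -
    let ?W = "(num_verts G + num_edges G + 2) ^ 2"
    have l: "length (concat (adj G)) \<le> 2 * num_edges G" by (rule length_concat_adj[OF G])
    \<comment> \<open>Exponent 2 is large enough for both word-size bounds, using that the adjacency
      array has at most \<open>2 * num_edges G\<close> cells.\<close>
    have "2 * num_verts G + 2 * num_edges G + 2 \<le> ?W" by (simp add: power2_eq_square)
    with l interpret machine_input G ?W by unfold_locales (use G in auto)
    have iff: "contains G P \<longleftrightarrow> (\<exists>u<num_verts G. reach False T u < num_verts G)"
      using contains_iff_embeds[OF fin forb] embeds_iff_reach[OF T] by (auto simp: gverts_def)
    obtain t s where run: "exec ?W (detect T) (input G) t s"
      "t \<le> (cost T + 40) * (n + length (concat (adj G)) + 1)"
      "regs s 0 = (if \<exists>v<n. reach False T v < n then 1 else 0)"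
      using run_detect[of T] unfolding run_def by blast
    note run(2)
    also have "(cost T + 40) * (n + length (concat (adj G)) + 1)
        \<le> (cost T + 40) * (2 * (num_verts G + num_edges G + 1))"
      using l by (intro mult_left_mono) auto
    also have "\<dots> = 2 * (cost T + 40) * (num_verts G + num_edges G + 1)"
      by (simp only: mult.assoc mult.left_commute)
    finally have "t \<le> 2 * (cost T + 40) * (num_verts G + num_edges G + 1)" .
    with run(1,3) iff show ?thesis by (intro exI[of _ t] exI[of _ s]) simp
  qed
  then show ?thesis by blast
qed

end
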